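(* Let $\Gamma$ be a finite, compact, connected, bipartite metric graph with first Betti number $\beta$. Then $$\lambda_{k+\beta}\big(L^{\rm a/st}(\Gamma)\big)=\lambda_{k+1}\big(L^{\rm st}(\Gamma)\big)\qquad\text{for all }k\in\mathbb N=\{1,2,\dots\}.$$
   Context: A finite compact metric graph $\Gamma$ consists of finitely many edges $e_n=[x_{2n-1},x_{2n}]\subset\mathbb R$, $n=1,\dots,E$, of positive lengths, and a vertex set $\mathcal V=\{v_1,\dots,v_V\}$ which is a partition of the endpoint set $\{x_1,\dots,x_{2E}\}$. The first Betti number is $\beta=E-V+1$. $\Gamma$ is bipartite if $\mathcal V=\mathcal V_1\sqcup\mathcal V_2$ such that every edge has one endpoint in a vertex of $\mathcal V_1$ and the other in a vertex of $\mathcal V_2$. $L^2(\Gamma)=\bigoplus_n L^2(e_n)$, $W^2_2(\Gamma\setminus\mathcal V)=\bigoplus_n W^2_2(e_n)$. $f(x_j)$ denotes the limit of $f$ at endpoint $x_j$, and $\partial f(x_j)=f'(x_j)$ if $x_j$ is a left endpoint, $-f'(x_j)$ if a right endpoint. The standard Laplacian $L^{\rm st}(\Gamma)$ acts as $-f''$ on each edge with domain all $f\in W^2_2(\Gamma\setminus\mathcal V)$ with, at every vertex $v$, $f(x_i)=f(x_j)$ for $x_i,x_j\in v$ and $\sum_{x_j\in v}\partial f(x_j)=0$. The anti-standard Laplacian $L^{\rm a/st}(\Gamma)$ acts as $-f''$ with domain all $f\in W^2_2(\Gamma\setminus\mathcal V)$ with, at every vertex $v$, $\sum_{x_j\in v}f(x_j)=0$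 and $\partial f(x_i)=\partial f(x_j)$ for $x_i,x_j\in v$. For a self-adjoint operator $A$ with purely discrete spectrum bounded below, $\lambda_1(A)\le\lambda_2(A)\le\dots$ denote its eigenvalues counted with multiplicities. *)

theory Defs
  imports "HOL-Analysis.Analysis"
begin

text \<open>A finite compact metric graph is encoded by: the number of edges E, edge lengths
  len n (for n < E), edge n being parametrised as the interval [0, len n]; the endpoints
  are numbered 0 ..< 2E, endpoint 2n is the left endpoint (x = 0) and endpoint 2n+1 the
  right endpoint (x = len n) of edge n; the vertex partition is given by a labelling
  vtx of the endpoints (two endpoints lie in the same vertex iff they have the same label).
  A function on the graph is f :: nat => real => real, f n being its restriction to edge n
  (and f is required to vanish outside the edges).\<close>

definition endpoints :: "nat \<Rightarrow> nat set" where
  "endpoints E = {..<2*E}"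

definition vertices :: "nat \<Rightarrow> (nat \<Rightarrow> nat) \<Rightarrow> nat set" where
  "vertices E vtx = vtx ` endpoints E"

definition endpoints_at :: "nat \<Rightarrow> (nat \<Rightarrow> nat) \<Rightarrow> nat \<Rightarrow> nat set" where
  "endpoints_at E vtx v = {j \<in> endpoints E. vtx j = v}"

definition betti :: "nat \<Rightarrow> (nat \<Rightarrow> nat) \<Rightarrow> nat" where
  "betti E vtx = E + 1 - card (vertices E vtx)"

definition graph_edges :: "nat \<Rightarrow> (nat \<Rightarrow> nat) \<Rightarrow> (nat \<times> nat) set" where
  "graph_edges E vtx = {(vtx (2*n), vtx (2*n+1)) | n. n < E}"

definition connected_graph :: "nat \<Rightarrow> (nat \<Rightarrow> nat) \<Rightarrow> bool" where
  "connected_graph E vtx \<longleftrightarrow>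
     (\<forall>u\<in>vertices E vtx. \<forall>w\<in>vertices E vtx.
        (u, w) \<in> (graph_edges E vtx \<union> (graph_edges E vtx)\<inverse>)\<^sup>*)"

definition bipartite_graph :: "nat \<Rightarrow> (nat \<Rightarrow> nat) \<Rightarrow> bool" where
  "bipartite_graph E vtx \<longleftrightarrow> (\<exists>P :: nat \<Rightarrow> bool. \<forall>n<E. P (vtx (2*n)) \<noteq> P (vtx (2*n+1)))"

text \<open>Value f(x_j) and normal derivative \<partial>f(x_j) at endpoint j (g is the derivative of f).\<close>
definition fval :: "(nat \<Rightarrow> real) \<Rightarrow> (nat \<Rightarrow> real \<Rightarrow> real) \<Rightarrow> nat \<Rightarrow> real" where
  "fval len f j = f (j div 2) (if even j then 0 else len (j div 2))"

definition dval :: "(nat \<Rightarrow> real) \<Rightarrow> (nat \<Rightarrow> real \<Rightarrow> real) \<Rightarrow> nat \<Rightarrow> real" where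
  "dval len g j = (if even j then g (j div 2) 0 else - g (j div 2) (len (j div 2)))"

datatype vertex_conditions = Standard | AntiStandard

definition vertex_cond ::
  "vertex_conditions \<Rightarrow> nat \<Rightarrow> (nat \<Rightarrow> real) \<Rightarrow> (nat \<Rightarrow> nat)
     \<Rightarrow> (nat \<Rightarrow> real \<Rightarrow> real) \<Rightarrow> (nat \<Rightarrow> real \<Rightarrow> real) \<Rightarrow> bool" where
  "vertex_cond vc E len vtx f g \<longleftrightarrow>
     (\<forall>v\<in>vertices E vtx.
        (case vc of
           Standard \<Rightarrow>
             (\<forall>i\<in>endpoints_at E vtx v. \<forall>j\<in>endpoints_at E vtx v. fval len f i = fval len f j)
             \<and> (\<Sum>j\<in>endpoints_at E vtx v. dval len g j) = 0
         | AntiStandard \<Rightarrow>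
             (\<Sum>j\<in>endpoints_at E vtx v. fval len f j) = 0
             \<and> (\<forall>i\<in>endpoints_at E vtx v. \<forall>j\<in>endpoints_at E vtx v. dval len g i = dval len g j)))"

text \<open>f is in the domain of the Laplacian with vertex conditions vc and -f'' = lam f
  (f = 0 allowed). Any W^2_2 solution of -f'' = lam f on an edge is smooth, so we
  require f to be twice differentiable on each closed edge.\<close>
definition is_eigfun ::
  "vertex_conditions \<Rightarrow> nat \<Rightarrow> (nat \<Rightarrow> real) \<Rightarrow> (nat \<Rightarrow> nat) \<Rightarrow> real
     \<Rightarrow> (nat \<Rightarrow> real \<Rightarrow> real) \<Rightarrow> bool" where
  "is_eigfun vc E len vtx lam f \<longleftrightarrow>
     (\<forall>n x. (E \<le> n \<or> x \<notin> {0..len n}) \<longrightarrow> f n x = 0) \<and>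
     (\<exists>g. (\<forall>n<E. \<forall>x\<in>{0..len n}.
              (f n has_real_derivative g n x) (at x within {0..len n}) \<and>
              (g n has_real_derivative (- lam * f n x)) (at x within {0..len n}))
          \<and> vertex_cond vc E len vtx f g)"

definition lin_indep_funs :: "(nat \<Rightarrow> real \<Rightarrow> real) set \<Rightarrow> bool" where
  "lin_indep_funs S \<longleftrightarrow>
     (\<forall>c. (\<forall>n x. (\<Sum>f\<in>S. c f * f n x) = 0) \<longrightarrow> (\<forall>f\<in>S. c f = 0))"

text \<open>Multiplicity of lam = dimension of the eigenspace (0 if lam is not an eigenvalue).\<close>
definition eig_mult ::
  "vertex_conditions \<Rightarrow> nat \<Rightarrow> (nat \<Rightarrow> real) \<Rightarrow> (nat \<Rightarrow> nat) \<Rightarrow> real \<Rightarrow> nat" where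
  "eig_mult vc E len vtx lam =
     Sup {card S | S. finite S \<and> S \<subseteq> {f. is_eigfun vc E len vtx lam f} \<and> lin_indep_funs S}"

text \<open>Eigenvalue counting function N(lam) = number of eigenvalues \<le> lam with multiplicity.\<close>
definition eig_count ::
  "vertex_conditions \<Rightarrow> nat \<Rightarrow> (nat \<Rightarrow> real) \<Rightarrow> (nat \<Rightarrow> nat) \<Rightarrow> real \<Rightarrow> nat" where
  "eig_count vc E len vtx lam =
     (\<Sum>mu\<in>{mu. mu \<le> lam \<and> 0 < eig_mult vc E len vtx mu}. eig_mult vc E len vtx mu)"

text \<open>k-th eigenvalue (k \<ge> 1) counted with multiplicities.\<close>
definition eigenvalue ::
  "vertex_conditions \<Rightarrow> nat \<Rightarrow> (nat \<Rightarrow> real) \<Rightarrow> (nat \<Rightarrow> nat) \<Rightarrow> nat \<Rightarrow> real" where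
  "eigenvalue vc E len vtx k = Inf {lam. k \<le> eig_count vc E len vtx lam}"

end

theory Submission
  imports Defs "HOL-Library.Function_Algebras"
begin

text \<open>Orient every edge from one class of the bipartition to the other. Differentiating along this
  orientation sends an eigenfunction \<open>f\<close> with eigenvalue \<open>\<mu>\<close> for one kind of vertex conditions to an
  eigenfunction with eigenvalue \<open>\<mu>\<close> for the other kind, and doing it twice is multiplication by \<open>-\<mu>\<close>;
  so the multiplicities of every \<open>\<mu> \<noteq> 0\<close> agree. Integration by parts excludes negative
  eigenvalues and shows that eigenfunctions for \<open>\<mu> = 0\<close> are constant on each edge. Under standard
  conditions these are the global constants; under anti-standard conditions they are, in the chosen
  orientation, the flows without sources, which form a space of dimension \<open>\<beta>\<close>. Hence the two
  counting functions differ by \<open>\<beta> - 1\<close> on \<open>[0, \<infinity>)\<close>. Discreteness of the spectrum does not enter: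
  the junk values of infinite sums and of suprema of unbounded sets coincide on both sides.\<close>

section \<open>Flows on connected graphs\<close>

text \<open>Signed incidence map of the directed multigraph with edges from \<open>s n\<close> to
  \<open>t n\<close>: outflow minus inflow at \<open>v\<close>. A loop contributes 0, and the kernel
  is the cycle space.\<close>

definition divergence :: "nat \<Rightarrow> (nat \<Rightarrow> 'v) \<Rightarrow> (nat \<Rightarrow> 'v) \<Rightarrow> (nat \<Rightarrow> real) \<Rightarrow> 'v \<Rightarrow> real" where
  "divergence E s t a v = (\<Sum>n<E. a n * (of_bool (s n = v) - of_bool (t n = v)))"

lemma divergence_cong:
  "(\<And>n. n < E \<Longrightarrow> a n = b n) \<Longrightarrow> divergence E s t a v = divergence E s t b v"
  by (simp add: divergence_def)

lemma divergence_diff: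
  "divergence E s t (\<lambda>n. a n - b n) v = divergence E s t a v - divergence E s t b v"
  by (simp add: divergence_def left_diff_distrib sum_subtractf)

lemma divergence_add:
  "divergence E s t (\<lambda>n. a n + b n) v = divergence E s t a v + divergence E s t b v"
  by (simp add: divergence_def distrib_right sum.distrib)

lemma divergence_sum:
  "divergence E s t (\<lambda>n. \<Sum>e\<in>F. x e * c e n) v = (\<Sum>e\<in>F. x e * divergence E s t (c e) v)"
  unfolding divergence_def sum_distrib_right sum_distrib_left
  by (subst sum.swap) (simp add: mult.assoc)

lemma divergence_single:
  assumes "e < E"
  shows "divergence E s t (\<lambda>n. if n = e then x else 0) v = x * (of_bool (s e = v) - of_bool (t e = v))"
  using assms by (simp add: divergence_def if_distrib[of "\<lambda>y. y * _"] sum.delta cong: if_cong)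

section \<open>Spanning trees and fundamental cycles\<close>

text \<open>A tree containing \<open>r\<close> grows along crossing edges, which \<open>cut\<close>
  (connectedness in terms of cuts) supplies until all of \<open>V\<close> is reached. Each step
  attaches a leaf, and the flow on the leaf edge is fixed by the divergence at the leaf. The last
  two conclusions express acyclicity and connectedness: the incidence map restricted to
  \<open>T\<close> is injective, and it reaches every \<open>b\<close> with total 0.\<close>

lemma spanning_tree:
  assumes fin: "finite V" and r: "r \<in> V"
    and st: "\<And>n. n < E \<Longrightarrow> s n \<in> V \<and> t n \<in> V"
    and cut: "\<And>W. W \<subseteq> V \<Longrightarrow> r \<in> W \<Longrightarrow> W \<noteq> V \<Longrightarrow> \<exists>n<E. (s n \<in> W) \<noteq> (t n \<in> W)"
  obtains T where "T \<subseteq> {..<E}" "card T + 1 = card V"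
    "\<forall>a. (\<forall>n. n \<notin> T \<longrightarrow> a n = 0) \<longrightarrow> (\<forall>v. divergence E s t a v = 0) \<longrightarrow> a = (\<lambda>n. 0)"
    "\<forall>b. (\<forall>v. v \<notin> V \<longrightarrow> b v = 0) \<longrightarrow> sum b V = 0 \<longrightarrow>
        (\<exists>a. (\<forall>n. n \<notin> T \<longrightarrow> a n = 0) \<and> (\<forall>v. divergence E s t a v = b v))"
proof -
  \<comment> \<open>Induction invariant: the conclusion for \<open>W\<close> instead of
    \<open>V\<close>, together with the condition that edges of \<open>T\<close> stay inside
    \<open>W\<close>. The latter makes the next vertex a leaf.\<close>
  define tree where "tree W T \<longleftrightarrow> T \<subseteq> {..<E} \<and> card T + 1 = card W \<and> (\<forall>n\<in>T. s n \<in> W \<and> t n \<in> W) \<and>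
    (\<forall>a. (\<forall>n. n \<notin> T \<longrightarrow> a n = 0) \<longrightarrow> (\<forall>v. divergence E s t a v = 0) \<longrightarrow> a = (\<lambda>n. 0)) \<and>
    (\<forall>b. (\<forall>v. v \<notin> W \<longrightarrow> b v = 0) \<longrightarrow> sum b W = 0 \<longrightarrow>
        (\<exists>a. (\<forall>n. n \<notin> T \<longrightarrow> a n = 0) \<and> (\<forall>v. divergence E s t a v = b v)))" for W T
  have "\<exists>W T. r \<in> W \<and> W \<subseteq> V \<and> card W = Suc m \<and> tree W T" if "Suc m \<le> card V" for m
    using that
  proof (induction m)
    case 0
    have "tree {r} {}"
      by (auto simp: tree_def divergence_def intro!: exI[of _ "\<lambda>n. 0"])
    moreover have "r \<in> {r}" "{r} \<subseteq> V" "card {r} = Suc 0"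
      using r by auto
    ultimately show ?case
      by blast
  next
    case (Suc m)
    then obtain W T where W: "r \<in> W" "W \<subseteq> V" "card W = Suc m" and "tree W T"
      by auto
    note T = \<open>tree W T\<close>[unfolded tree_def]
    have "W \<noteq> V"
      using W(3) Suc.prems by auto
    then obtain e where e: "e < E" "(s e \<in> W) \<noteq> (t e \<in> W)"
      using cut W by blast
    define u where "u = (if s e \<in> W then s e else t e)"
    define w where "w = (if s e \<in> W then t e else s e)"
    \<comment> \<open>\<open>\<tau>\<close> is the divergence at the new leaf \<open>w\<close> of a
      unit flow through \<open>e\<close>; its square is 1.\<close>
    define \<tau> :: real where "\<tau> = (if s e \<in> W then -1 else 1)"
    have u: "u \<in> W" and w: "w \<notin> W" "w \<in> V"
      using e st[OF e(1)] by (auto simp: u_def w_def)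
    have eT: "e \<notin> T" and finT: "finite T" and finW: "finite W"
      using T e(2) finite_subset[of T "{..<E}"] finite_subset[OF W(2) fin] by auto
    have single: "of_bool (s e = v) - of_bool (t e = v) = \<tau> * (of_bool (w = v) - of_bool (u = v))" for v
      by (auto simp: u_def w_def \<tau>_def)
    have "tree (insert w W) (insert e T)"
      unfolding tree_def
    proof (intro conjI allI impI ballI)
      fix a :: "nat \<Rightarrow> real"
      assume a: "\<forall>n. n \<notin> insert e T \<longrightarrow> a n = 0" "\<forall>v. divergence E s t a v = 0"
      \<comment> \<open>No edge of \<open>T\<close> meets \<open>w\<close>, so only \<open>e\<close>
        contributes there; this forces \<open>a e = 0\<close> and reduces the claim to
        \<open>T\<close>.\<close>
      have "divergence E s t a w = divergence E s t (\<lambda>n. if n = e then a e else 0) w"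
        unfolding divergence_def
      proof (rule sum.cong)
        fix n
        have "n \<in> T \<Longrightarrow> s n \<noteq> w \<and> t n \<noteq> w"
          using T w by blast
        then show "a n * (of_bool (s n = w) - of_bool (t n = w)) =
            (if n = e then a e else 0) * (of_bool (s n = w) - of_bool (t n = w))"
          using a(1) by (cases "n \<in> T") auto
      qed simp
      then have "a e * \<tau> = 0"
        using a(2) divergence_single[OF e(1), of s t "a e" w] single[of w] u w by auto
      then have "a e = 0"
        by (auto simp: \<tau>_def split: if_splits)
      then have "\<forall>n. n \<notin> T \<longrightarrow> a n = 0"
        using a(1) by auto
      then show "a = (\<lambda>n. 0)"
        using T a(2) by blast
    next
      fix b :: "'a \<Rightarrow> real"
      assume b: "\<forall>v. v \<notin> insert w W \<longrightarrow> b v = 0" "sum b (insert w W) = 0"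
      \<comment> \<open>The flow \<open>\<tau> * b w\<close> through \<open>e\<close> has divergence
        \<open>b w * d\<close>. It settles the leaf, and the remainder \<open>b'\<close> lives on
        \<open>W\<close> with total 0, so \<open>T\<close> can carry it.\<close>
      define d :: "'a \<Rightarrow> real" where "d v = of_bool (w = v) - of_bool (u = v)" for v
      define b' where "b' v = b v - b w * d v" for v
      have "sum d W = -1"
        using finW u w by (simp add: d_def sum_subtractf of_bool_def)
      then have "sum b' W = 0"
        using b(2) finW w by (simp add: b'_def sum_subtractf flip: sum_distrib_left)
      moreover have "\<forall>v. v \<notin> W \<longrightarrow> b' v = 0"
        using b(1) u w by (auto simp: b'_def d_def)
      ultimately obtain a where a: "\<forall>n. n \<notin> T \<longrightarrow> a n = 0" "\<forall>v. divergence E s t a v = b' v"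
        using T by blast
      let ?a = "\<lambda>n. a n + (if n = e then \<tau> * b w else 0)"
      have "divergence E s t ?a v = b v" for v
        unfolding divergence_add divergence_single[OF e(1)] single
        using a(2) by (simp add: b'_def d_def \<tau>_def)
      then show "\<exists>a. (\<forall>n. n \<notin> insert e T \<longrightarrow> a n = 0) \<and> (\<forall>v. divergence E s t a v = b v)"
        using a(1) by (intro exI[of _ ?a]) auto
    qed (use T e finT finW eT w u in \<open>auto simp: u_def w_def split: if_splits\<close>)
    then show ?case
      using W w finW by (intro exI[of _ "insert w W"] exI[of _ "insert e T"]) auto
  qed
  from this[of "card V - 1"] have "\<exists>W T. r \<in> W \<and> W \<subseteq> V \<and> card W = card V \<and> tree W T"
    using card_gt_0_iff[of V] fin r by (cases "card V") auto
  then obtain W T where "W \<subseteq> V" "card W = card V" and T: "tree W T"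
    by blast
  then have "W = V"
    using fin by (simp add: card_subset_eq)
  show ?thesis
    by (rule that[of T]) (use T in \<open>simp_all add: tree_def \<open>W = V\<close>\<close>)
qed

text \<open>Every edge outside a spanning tree closes exactly one fundamental cycle
  \<open>c e\<close>. A flow without sources is determined by its values off the tree, which are
  therefore its coordinates. The expansion is claimed for \<open>n < E\<close> only, since
  \<open>divergence\<close> does not see other indices.\<close>

lemma cycle_basis:
  assumes fin: "finite V" and r: "r \<in> V"
    and st: "\<And>n. n < E \<Longrightarrow> s n \<in> V \<and> t n \<in> V"
    and cut: "\<And>W. W \<subseteq> V \<Longrightarrow> r \<in> W \<Longrightarrow> W \<noteq> V \<Longrightarrow> \<exists>n<E. (s n \<in> W) \<noteq> (t n \<in> W)"
  obtains F c where "F \<subseteq> {..<E}" "card F + card V = E + 1"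
    "\<forall>e\<in>F. \<forall>v. divergence E s t (c e) v = 0"
    "\<forall>e\<in>F. \<forall>m\<in>F. c e m = of_bool (e = m)"
    "\<forall>a. (\<forall>v. divergence E s t a v = 0) \<longrightarrow> (\<forall>n<E. a n = (\<Sum>e\<in>F. a e * c e n))"
proof -
  obtain T where T: "T \<subseteq> {..<E}" "card T + 1 = card V"
    and inj: "\<forall>a. (\<forall>n. n \<notin> T \<longrightarrow> a n = 0) \<longrightarrow> (\<forall>v. divergence E s t a v = 0) \<longrightarrow> a = (\<lambda>n. 0)"
    and surj: "\<forall>b. (\<forall>v. v \<notin> V \<longrightarrow> b v = 0) \<longrightarrow> sum b V = 0 \<longrightarrow>
        (\<exists>a. (\<forall>n. n \<notin> T \<longrightarrow> a n = 0) \<and> (\<forall>v. divergence E s t a v = b v))"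
    by (rule spanning_tree[OF fin r st cut]) blast
  define F where "F = {..<E} - T"
  \<comment> \<open>The flow found here is the tree path from \<open>s e\<close> to
    \<open>t e\<close>; subtracting it from the unit flow on \<open>e\<close> gives the fundamental
    cycle.\<close>
  have "\<exists>a. (\<forall>n. n \<notin> T \<longrightarrow> a n = 0) \<and>
      (\<forall>v. divergence E s t a v = of_bool (s e = v) - of_bool (t e = v))" if "e \<in> F" for e
  proof (rule surj[rule_format])
    have "s e \<in> V" "t e \<in> V"
      using st that by (auto simp: F_def)
    then show "(\<Sum>v\<in>V. of_bool (s e = v) - of_bool (t e = v) :: real) = 0"
      and "\<And>v. v \<notin> V \<Longrightarrow> of_bool (s e = v) - of_bool (t e = v) = (0::real)"
      using fin by (auto simp: sum_subtractf of_bool_def sum.delta)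
  qed
  then obtain h where h: "\<And>e n. e \<in> F \<Longrightarrow> n \<notin> T \<Longrightarrow> h e n = 0"
    "\<And>e v. e \<in> F \<Longrightarrow> divergence E s t (h e) v = of_bool (s e = v) - of_bool (t e = v)"
    by metis
  define c where "c e n = (if n = e then 1 else 0) - h e n" for e n
  have div_c: "divergence E s t (c e) v = 0" if "e \<in> F" for e v
    using that h(2)[OF that] unfolding c_def divergence_diff
    by (subst divergence_single) (auto simp: F_def)
  have span: "a n = (\<Sum>e\<in>F. a e * c e n)" if a: "\<And>v. divergence E s t a v = 0" and n: "n < E" for a n
  proof -
    \<comment> \<open>Cut off at \<open>E\<close> because \<open>inj\<close> asks for vanishing at
      every index outside \<open>T\<close>, while \<open>a\<close> is arbitrary beyond
      \<open>E\<close>.\<close>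
    define d where "d n = (if n < E then a n - (\<Sum>e\<in>F. a e * c e n) else 0)" for n
    have "d = (\<lambda>n. 0)"
    proof (rule inj[rule_format])
      show "d n = 0" if "n \<notin> T" for n
      proof (cases "n < E")
        case True
        then have "n \<in> F" "finite F"
          using that by (auto simp: F_def)
        moreover have "(\<Sum>e\<in>F. a e * c e n) = (\<Sum>e\<in>F. if e = n then a e else 0)"
          using h(1) that by (intro sum.cong) (auto simp: c_def)
        ultimately show ?thesis
          by (simp add: d_def)
      qed (simp add: d_def)
      have "divergence E s t d v = divergence E s t (\<lambda>n. a n - (\<Sum>e\<in>F. a e * c e n)) v" for v
        by (rule divergence_cong) (simp add: d_def)
      then show "divergence E s t d v = 0" for v
        by (simp add: divergence_diff divergence_sum a div_c)
    qed
    then have "d n = 0"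
      by simp
    then show ?thesis
      using n by (simp add: d_def)
  qed
  have "card F + card T = E"
    using T(1) card_mono[OF _ T(1)] by (simp add: F_def card_Diff_subset finite_subset)
  then show ?thesis
    using that[of F c] T(2) div_c h(1) span by (auto simp: F_def c_def)
qed

section \<open>Linear independence and multiplicities\<close>

text \<open>Makes the library's span and the exchange bound on independent sets available; addition
  of functions is pointwise.\<close>

interpretation edge_funs: vector_space "\<lambda>(c::real) (f::nat \<Rightarrow> real \<Rightarrow> real) n x. c * f n x"
  by unfold_locales (simp_all add: fun_eq_iff distrib_left distrib_right mult.assoc)

lemma sum_edge_funs_apply:
  "(\<Sum>f\<in>S. (\<lambda>n x. c f * h f n x)) n x = (\<Sum>f\<in>S. c f * (h f n x :: real))"
  by (induction S rule: infinite_finite_induct) auto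

lemma lin_indep_funs_iff:
  "finite S \<Longrightarrow> lin_indep_funs S \<longleftrightarrow> edge_funs.independent S"
proof -
  assume "finite S"
  have "(\<Sum>f\<in>S. (\<lambda>n x. c f * f n x)) = 0 \<longleftrightarrow> (\<forall>n x. (\<Sum>f\<in>S. c f * f n x) = 0)" for c
    unfolding fun_eq_iff sum_edge_funs_apply[where h = "\<lambda>f. f"] zero_fun_apply ..
  then show ?thesis
    unfolding lin_indep_funs_def edge_funs.dependent_finite[OF \<open>finite S\<close>] by auto
qed

text \<open>Passes from independence of a family to independence of its image set. Two equal members
  would satisfy a relation with coefficients 1 and -1, so no cardinality is lost.\<close>

lemma lin_indep_funs_image:
  assumes fin: "finite S"
    and indep: "\<And>c. (\<And>n x. (\<Sum>f\<in>S. c f * D f n x) = 0) \<Longrightarrow> \<forall>f\<in>S. c f = 0"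
  shows "inj_on D S" and "lin_indep_funs (D ` S)"
proof -
  show inj: "inj_on D S"
  proof (rule inj_onI, rule ccontr)
    fix f h assume fh: "f \<in> S" "h \<in> S" "D f = D h" "f \<noteq> h"
    let ?c = "\<lambda>k. (if k = f then 1 else 0) - (if k = h then 1 else 0) :: real"
    have "(\<Sum>k\<in>S. ?c k * D k n x) = 0" for n x
    proof -
      have "(\<Sum>k\<in>S. ?c k * D k n x) =
          (\<Sum>k\<in>S. if k = f then D k n x else 0) - (\<Sum>k\<in>S. if k = h then D k n x else 0)"
        unfolding sum_subtractf[symmetric] by (intro sum.cong) auto
      then show ?thesis
        using fin fh by simp
    qed
    then have "?c f = 0"
      using indep[of ?c] fh by blast
    with fh show False
      by simp
  qed
  show "lin_indep_funs (D ` S)"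
    unfolding lin_indep_funs_def
  proof (intro allI impI)
    fix c assume "\<forall>n x. (\<Sum>f\<in>D ` S. c f * f n x) = 0"
    then have "\<forall>f\<in>S. c (D f) = 0"
      by (intro indep[of "\<lambda>f. c (D f)"]) (simp add: sum.reindex[OF inj])
    then show "\<forall>f\<in>D ` S. c f = 0"
      by blast
  qed
qed

section \<open>Multiplicities from bases, and the counting function\<close>

text \<open>A basis attains the supremum, and by the exchange lemma no independent set in its span
  is larger.\<close>

lemma eig_mult_eq_card:
  assumes "finite B" and "\<And>b. b \<in> B \<Longrightarrow> is_eigfun vc E len vtx \<mu> (h b)"
    and indep: "\<And>c. (\<And>n x. (\<Sum>b\<in>B. c b * h b n x) = 0) \<Longrightarrow> \<forall>b\<in>B. c b = 0"
    and span: "\<And>f. is_eigfun vc E len vtx \<mu> f \<Longrightarrow> \<exists>c. \<forall>n x. f n x = (\<Sum>b\<in>B. c b * h b n x)"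
  shows "eig_mult vc E len vtx \<mu> = card B"
  unfolding eig_mult_def
proof (rule cSup_eq_maximum)
  show "card B \<in> {card S |S. finite S \<and> S \<subseteq> {f. is_eigfun vc E len vtx \<mu> f} \<and> lin_indep_funs S}"
    using assms(1,2) lin_indep_funs_image[OF assms(1) indep, of h]
    by (auto intro!: exI[of _ "h ` B"] simp: card_image)
next
  fix m
  assume "m \<in> {card S |S. finite S \<and> S \<subseteq> {f. is_eigfun vc E len vtx \<mu> f} \<and> lin_indep_funs S}"
  then obtain S where S: "m = card S" "finite S" "lin_indep_funs S" "S \<subseteq> {f. is_eigfun vc E len vtx \<mu> f}"
    by blast
  have "S \<subseteq> edge_funs.span (h ` B)"
  proof
    fix f assume "f \<in> S"
    then obtain c where "\<forall>n x. f n x = (\<Sum>b\<in>B. c b * h b n x)"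
      using span[of f] S(4) by blast
    then have "f = (\<Sum>b\<in>B. (\<lambda>n x. c b * h b n x))"
      by (simp add: fun_eq_iff sum_edge_funs_apply)
    also have "\<dots> \<in> edge_funs.span (h ` B)"
      by (intro edge_funs.span_sum edge_funs.span_scale edge_funs.span_base imageI)
    finally show "f \<in> edge_funs.span (h ` B)" .
  qed
  then have "card S \<le> card (h ` B)"
    using edge_funs.independent_span_bound S(2,3) assms(1) lin_indep_funs_iff by blast
  then show "m \<le> card B"
    using S(1) card_image_le[OF assms(1), of h] by simp
qed

lemma eig_mult_trivial:
  assumes "\<And>f n x. is_eigfun vc E len vtx \<mu> f \<Longrightarrow> f n x = 0"
  shows "eig_mult vc E len vtx \<mu> = 0"
  using eig_mult_eq_card[of "{}" vc E len vtx \<mu> undefined] assms by simp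

text \<open>Given \<open>neg\<close>, the index set of the count differs from \<open>P\<close> at
  most by the point 0, which does not affect finiteness. The value 0 in the other case is that of
  \<open>sum\<close> over an infinite set.\<close>

lemma eig_count_eq:
  assumes neg: "\<And>\<mu>. \<mu> < 0 \<Longrightarrow> eig_mult vc E len vtx \<mu> = 0" and "0 \<le> lam"
  defines "P \<equiv> {\<mu>. 0 < \<mu> \<and> \<mu> \<le> lam \<and> 0 < eig_mult vc E len vtx \<mu>}"
  shows "eig_count vc E len vtx lam =
    (if finite P then eig_mult vc E len vtx 0 + (\<Sum>\<mu>\<in>P. eig_mult vc E len vtx \<mu>) else 0)"
proof -
  let ?m = "eig_mult vc E len vtx"
  have "{\<mu>. \<mu> \<le> lam \<and> 0 < ?m \<mu>} = (if ?m 0 = 0 then P else insert 0 P)"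
    using assms by (auto simp: P_def) (metis less_irrefl linorder_cases)+
  moreover have "0 \<notin> P"
    by (simp add: P_def)
  ultimately show ?thesis
    by (simp add: eig_count_def)
qed

section \<open>Eigenfunctions on bipartite graphs\<close>

lemma fval_double: "fval len f (2 * n) = f n 0" "fval len f (2 * n + 1) = f n (len n)"
  by (simp_all add: fval_def)

lemma dval_double: "dval len g (2 * n) = g n 0" "dval len g (2 * n + 1) = - g n (len n)"
  by (simp_all add: dval_def)

lemma endpoint_double_cases:
  assumes "j \<in> endpoints E"
  obtains n where "n < E" "j = 2 * n" | n where "n < E" "j = 2 * n + 1"
  using assms by (cases "even j") (auto simp: endpoints_def elim!: evenE oddE)

lemma sum_endpoints: "sum h (endpoints E) = (\<Sum>n<E. h (2 * n) + h (2 * n + 1))"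
  by (induction E) (simp_all add: endpoints_def add.assoc)

lemma real_derivative_unique_on_interval:
  "(f has_real_derivative d) (at x within {0..l}) \<Longrightarrow> (f has_real_derivative d') (at x within {0..l}) \<Longrightarrow>
    0 < l \<Longrightarrow> x \<in> {0..l} \<Longrightarrow> d = d'"
  using vector_derivative_unique_within_closed_interval[of 0 l x f d d']
  by (simp add: has_real_derivative_iff_has_vector_derivative)

lemma real_derivative_transform:
  "x \<in> A \<Longrightarrow> (\<And>y. y \<in> A \<Longrightarrow> f y = h y) \<Longrightarrow> (h has_real_derivative d) (at x within A) \<Longrightarrow>
    (f has_real_derivative d) (at x within A)"
  unfolding has_field_derivative_def by (rule has_derivative_transform)

section \<open>Integration by parts and nonpositive eigenvalues\<close>

text \<open>The boundary term of Green's formula vanishes vertex by vertex: under either kind of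
  conditions one factor is constant at the vertex and the other sums to 0.\<close>

lemma green_vertex:
  assumes "vertex_cond vc E len vtx f g"
  shows "(\<Sum>j\<in>endpoints E. fval len f j * dval len g j) = 0"
proof -
  have "(\<Sum>j\<in>endpoints_at E vtx v. fval len f j * dval len g j) = 0" if v: "v \<in> vertices E vtx" for v
  proof -
    obtain i where i: "i \<in> endpoints_at E vtx v"
      using v by (auto simp: vertices_def endpoints_at_def)
    show ?thesis
    proof (cases vc)
      case Standard
      note cond = assms[unfolded vertex_cond_def Standard vertex_conditions.case, rule_format, OF v]
      have "(\<Sum>j\<in>endpoints_at E vtx v. fval len f j * dval len g j) =
          (\<Sum>j\<in>endpoints_at E vtx v. fval len f i * dval len g j)"
        by (rule sum.cong) (use cond i in metis)+
      then show ?thesis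
        using cond by (metis sum_distrib_left mult_zero_right)
    next
      case AntiStandard
      note cond = assms[unfolded vertex_cond_def AntiStandard vertex_conditions.case, rule_format, OF v]
      have "(\<Sum>j\<in>endpoints_at E vtx v. fval len f j * dval len g j) =
          (\<Sum>j\<in>endpoints_at E vtx v. fval len f j * dval len g i)"
        by (rule sum.cong) (use cond i in metis)+
      then show ?thesis
        using cond by (metis sum_distrib_right mult_zero_left)
    qed
  qed
  moreover have "(\<Sum>j\<in>endpoints E. fval len f j * dval len g j) =
      (\<Sum>v\<in>vertices E vtx. \<Sum>j\<in>endpoints_at E vtx v. fval len f j * dval len g j)"
    unfolding vertices_def endpoints_at_def
    by (rule sum.image_gen) (simp add: endpoints_def)
  ultimately show ?thesis
    by simp
qed

text \<open>The derivative of \<open>f * g\<close> is the nonnegative function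
  \<open>g\<^sup>2 - \<mu> * f\<^sup>2\<close>. Its integrals over the edges add up to a boundary
  term that is 0 by \<open>green_vertex\<close>, so by continuity it vanishes on every edge, and
  with it both of its summands.\<close>

lemma nonpos_eigfun:
  assumes pos: "\<forall>n<E. 0 < len n" and "\<mu> \<le> 0"
    and deriv: "\<forall>n<E. \<forall>x\<in>{0..len n}.
        (f n has_real_derivative g n x) (at x within {0..len n}) \<and>
        (g n has_real_derivative (- \<mu> * f n x)) (at x within {0..len n})"
    and vc: "vertex_cond vc E len vtx f g"
    and n: "n < E" and x: "x \<in> {0..len n}"
  shows "g n x = 0" and "\<mu> * f n x = 0"
proof -
  define q where "q n x = (g n x)\<^sup>2 - \<mu> * (f n x)\<^sup>2" for n x
  have q_nonneg: "0 \<le> q n x" for n x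
    using \<open>\<mu> \<le> 0\<close> by (simp add: q_def mult_nonpos_nonneg order_trans[OF _ zero_le_power2])
  have q_int: "(q n has_integral (f n (len n) * g n (len n) - f n 0 * g n 0)) {0..len n}"
    if "n < E" for n
  proof (rule fundamental_theorem_of_calculus)
    show "0 \<le> len n"
      using pos that by (simp add: less_imp_le)
    show "((\<lambda>x. f n x * g n x) has_vector_derivative q n x) (at x within {0..len n})"
      if "x \<in> {0..len n}" for x
      unfolding has_real_derivative_iff_has_vector_derivative[symmetric]
      by (rule DERIV_cong[OF DERIV_mult[OF deriv[rule_format, THEN conjunct1, OF \<open>n < E\<close> that]
            deriv[rule_format, THEN conjunct2, OF \<open>n < E\<close> that]]])
        (simp add: q_def power2_eq_square)
  qed
  have incr_nonneg: "0 \<le> f n (len n) * g n (len n) - f n 0 * g n 0" if "n < E" for n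
    using has_integral_nonneg[OF q_int[OF that]] q_nonneg by blast
  \<comment> \<open>The minus sign arises because \<open>dval\<close> differentiates into the edge
    at both ends.\<close>
  have "(\<Sum>n<E. f n (len n) * g n (len n) - f n 0 * g n 0) =
      - (\<Sum>j\<in>endpoints E. fval len f j * dval len g j)"
    unfolding sum_endpoints fval_double dval_double by (simp flip: sum_negf)
  then have "(\<Sum>n<E. f n (len n) * g n (len n) - f n 0 * g n 0) = 0"
    using green_vertex[OF vc] by simp
  then have "f n (len n) * g n (len n) - f n 0 * g n 0 = 0"
    using incr_nonneg n by (subst (asm) sum_nonneg_eq_0_iff) auto
  then have int0: "(q n has_integral 0) (cbox 0 (len n))"
    using q_int[OF n] by simp
  have cont: "continuous_on (cbox 0 (len n)) (f n)" "continuous_on (cbox 0 (len n)) (g n)"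
    using deriv n by (auto intro!: DERIV_continuous_on)
  have "q n x = 0"
  proof (rule has_integral_0_cbox_imp_0[OF _ _ int0])
    show "continuous_on (cbox 0 (len n)) (q n)"
      unfolding q_def by (intro continuous_intros cont)
    show "box 0 (len n) \<noteq> {}"
      using pos n by auto
  qed (use x q_nonneg in auto)
  moreover have "0 \<le> - \<mu> * (f n x)\<^sup>2"
    using \<open>\<mu> \<le> 0\<close> by (simp add: mult_nonpos_nonneg)
  ultimately have "(g n x)\<^sup>2 = 0 \<and> \<mu> * (f n x)\<^sup>2 = 0"
    using zero_le_power2[of "g n x"] unfolding q_def by linarith
  then show "g n x = 0" "\<mu> * f n x = 0"
    by auto
qed

section \<open>Duality between the two kinds of vertex conditions\<close>

fun dual_cond :: "vertex_conditions \<Rightarrow> vertex_conditions" where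
  "dual_cond Standard = AntiStandard"
| "dual_cond AntiStandard = Standard"

definition edgewise_const :: "nat \<Rightarrow> (nat \<Rightarrow> real) \<Rightarrow> (nat \<Rightarrow> real) \<Rightarrow> nat \<Rightarrow> real \<Rightarrow> real" where
  "edgewise_const E len a n x = (if n < E \<and> x \<in> {0..len n} then a n else 0)"

locale bipartite_metric_graph =
  fixes E :: nat and len :: "nat \<Rightarrow> real" and vtx :: "nat \<Rightarrow> nat" and P :: "nat \<Rightarrow> bool"
  assumes pos: "\<forall>n<E. 0 < len n"
    and conn: "connected_graph E vtx"
    and bip: "\<forall>n<E. P (vtx (2*n)) \<noteq> P (vtx (2*n+1))"
begin

text \<open>For an edge \<open>n < E\<close>, \<open>sign (vtx (2*n))\<close> tells whether its
  parametrisation agrees with the orientation out of the class \<open>P\<close>; multiplying the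
  derivative by it gives the derivative along that orientation.\<close>

definition sign :: "nat \<Rightarrow> real" where "sign v = (if P v then 1 else -1)"

lemma sign_nz: "sign v \<noteq> 0"
  by (simp add: sign_def)

lemma sign_right: "n < E \<Longrightarrow> sign (vtx (2 * n + 1)) = - sign (vtx (2 * n))"
  using bip by (auto simp: sign_def)

text \<open>Otherwise no path starting at \<open>r\<close> could leave \<open>W\<close>. This is
  connectedness in the form that \<open>spanning_tree\<close> asks for.\<close>

lemma ex_crossing_edge:
  assumes "W \<subseteq> vertices E vtx" "r \<in> W" "W \<noteq> vertices E vtx"
  shows "\<exists>n<E. (vtx (2*n) \<in> W) \<noteq> (vtx (2*n+1) \<in> W)"
proof (rule ccontr)
  assume no: "\<not> ?thesis"
  have "w \<in> W" if "w \<in> vertices E vtx" for w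
  proof -
    have "(r, w) \<in> (graph_edges E vtx \<union> (graph_edges E vtx)\<inverse>)\<^sup>*"
      using conn assms that by (auto simp: connected_graph_def)
    then show ?thesis
      by induction (use assms no in \<open>auto simp: graph_edges_def\<close>)
  qed
  with assms show False
    by blast
qed

text \<open>At right endpoints the sign change of \<open>sign_right\<close> cancels the minus in
  \<open>dval\<close>. Hence at all endpoints of a vertex \<open>v\<close>, values and normal
  derivatives are exchanged up to factors depending only on \<open>v\<close> and
  \<open>\<mu>\<close>, and so are the two conditions.\<close>

lemma vertex_cond_dual:
  assumes vc: "vertex_cond vc E len vtx f g"
  shows "vertex_cond (dual_cond vc) E len vtx
    (\<lambda>n x. sign (vtx (2*n)) * g n x) (\<lambda>n x. sign (vtx (2*n)) * (- \<mu> * f n x))"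
proof -
  define f' where "f' n x = sign (vtx (2*n)) * g n x" for n x
  define g' where "g' n x = sign (vtx (2*n)) * (- \<mu> * f n x)" for n x
  have val: "fval len f' j = sign v * dval len g j" "dval len g' j = - \<mu> * sign v * fval len f j"
    if "j \<in> endpoints_at E vtx v" for j v
  proof -
    have j: "j \<in> endpoints E" "v = vtx j"
      using that by (auto simp: endpoints_at_def)
    from j(1) show "fval len f' j = sign v * dval len g j" "dval len g' j = - \<mu> * sign v * fval len f j"
      by (cases rule: endpoint_double_cases; simp add: j(2) fval_def dval_def f'_def g'_def sign_right[simplified])+
  qed
  have sums: "(\<Sum>j\<in>endpoints_at E vtx v. fval len f' j) = sign v * (\<Sum>j\<in>endpoints_at E vtx v. dval len g j)"
    "(\<Sum>j\<in>endpoints_at E vtx v. dval len g' j) = - \<mu> * sign v * (\<Sum>j\<in>endpoints_at E vtx v. fval len f j)" for v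
    unfolding sum_distrib_left by (intro sum.cong refl val; assumption)+
  have "vertex_cond (dual_cond vc) E len vtx f' g'"
    unfolding vertex_cond_def
  proof
    fix v assume v: "v \<in> vertices E vtx"
    show "case dual_cond vc of
        Standard \<Rightarrow> (\<forall>i\<in>endpoints_at E vtx v. \<forall>j\<in>endpoints_at E vtx v. fval len f' i = fval len f' j) \<and>
          (\<Sum>j\<in>endpoints_at E vtx v. dval len g' j) = 0
      | AntiStandard \<Rightarrow> (\<Sum>j\<in>endpoints_at E vtx v. fval len f' j) = 0 \<and>
          (\<forall>i\<in>endpoints_at E vtx v. \<forall>j\<in>endpoints_at E vtx v. dval len g' i = dval len g' j)"
    proof (cases vc)
      case Standard
      have "\<forall>i\<in>endpoints_at E vtx v. \<forall>j\<in>endpoints_at E vtx v. fval len f i = fval len f j"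
        "(\<Sum>j\<in>endpoints_at E vtx v. dval len g j) = 0"
        using vc[unfolded vertex_cond_def, rule_format, OF v] unfolding Standard vertex_conditions.case by blast+
      moreover have "dval len g' i = dval len g' j"
        if "i \<in> endpoints_at E vtx v" "j \<in> endpoints_at E vtx v" for i j
        unfolding val(2)[OF that(1)] val(2)[OF that(2)] using calculation(1) that by metis
      ultimately show ?thesis
        unfolding Standard dual_cond.simps vertex_conditions.case sums by (metis mult_zero_right)
    next
      case AntiStandard
      have "\<forall>i\<in>endpoints_at E vtx v. \<forall>j\<in>endpoints_at E vtx v. dval len g i = dval len g j"
        "(\<Sum>j\<in>endpoints_at E vtx v. fval len f j) = 0"
        using vc[unfolded vertex_cond_def, rule_format, OF v] unfolding AntiStandard vertex_conditions.case by blast+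
      moreover have "fval len f' i = fval len f' j"
        if "i \<in> endpoints_at E vtx v" "j \<in> endpoints_at E vtx v" for i j
        unfolding val(1)[OF that(1)] val(1)[OF that(2)] using calculation(1) that by metis
      ultimately show ?thesis
        unfolding AntiStandard dual_cond.simps vertex_conditions.case sums by (metis mult_zero_right)
    qed
  qed
  then show ?thesis
    unfolding f'_def g'_def .
qed

text \<open>Only endpoint values enter, and positive lengths place both endpoints in the closed
  edge.\<close>

lemma vertex_cond_cong:
  assumes "\<And>n x. n < E \<Longrightarrow> x \<in> {0..len n} \<Longrightarrow> f n x = f' n x"
    and "\<And>n x. n < E \<Longrightarrow> x \<in> {0..len n} \<Longrightarrow> g n x = g' n x"
  shows "vertex_cond vc E len vtx f g \<longleftrightarrow> vertex_cond vc E len vtx f' g'"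
proof -
  have "fval len f j = fval len f' j \<and> dval len g j = dval len g' j" if "j \<in> endpoints E" for j
  proof -
    have "j div 2 < E" "0 \<le> len (j div 2)"
      using that pos by (auto simp: endpoints_def less_mult_imp_div_less mult.commute less_imp_le)
    then show ?thesis
      using assms by (simp add: fval_def dval_def)
  qed
  then have "\<And>v j. j \<in> endpoints_at E vtx v \<Longrightarrow> fval len f j = fval len f' j \<and> dval len g j = dval len g' j"
    by (simp add: endpoints_at_def)
  then show ?thesis
    unfolding vertex_cond_def by (auto split: vertex_conditions.split cong: sum.cong ball_cong)
qed

text \<open>\<open>S'\<close> consists of the derivatives along the orientation. Differentiating a
  linear relation among them once more yields \<open>- \<mu>\<close> times the same relation among
  the members of \<open>S\<close>.\<close>

lemma dual_eigfuns:
  assumes S: "finite S" "S \<subseteq> {f. is_eigfun vc E len vtx \<mu> f}" "lin_indep_funs S" and "\<mu> \<noteq> 0"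
  obtains S' where "finite S'" "S' \<subseteq> {f. is_eigfun (dual_cond vc) E len vtx \<mu> f}"
    "lin_indep_funs S'" "card S' = card S"
proof -
  have "\<forall>f\<in>S. \<exists>g. (\<forall>n<E. \<forall>x\<in>{0..len n}.
        (f n has_real_derivative g n x) (at x within {0..len n}) \<and>
        (g n has_real_derivative (- \<mu> * f n x)) (at x within {0..len n}))
      \<and> vertex_cond vc E len vtx f g"
    using S(2) by (auto simp: is_eigfun_def)
  then obtain G where "\<forall>f\<in>S. (\<forall>n<E. \<forall>x\<in>{0..len n}.
        (f n has_real_derivative G f n x) (at x within {0..len n}) \<and>
        (G f n has_real_derivative (- \<mu> * f n x)) (at x within {0..len n}))
      \<and> vertex_cond vc E len vtx f (G f)"
    by metis
  then have G: "\<And>f n x. f \<in> S \<Longrightarrow> n < E \<Longrightarrow> x \<in> {0..len n} \<Longrightarrow>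
        (f n has_real_derivative G f n x) (at x within {0..len n})"
      "\<And>f n x. f \<in> S \<Longrightarrow> n < E \<Longrightarrow> x \<in> {0..len n} \<Longrightarrow>
        (G f n has_real_derivative (- \<mu> * f n x)) (at x within {0..len n})"
      "\<And>f. f \<in> S \<Longrightarrow> vertex_cond vc E len vtx f (G f)"
    by blast+
  define D where "D f n x = (if n < E \<and> x \<in> {0..len n} then sign (vtx (2*n)) * G f n x else 0)" for f n x
  have "is_eigfun (dual_cond vc) E len vtx \<mu> (D f)" if f: "f \<in> S" for f
    unfolding is_eigfun_def
  proof (intro conjI exI[of _ "\<lambda>n x. sign (vtx (2*n)) * (- \<mu> * f n x)"] allI impI ballI)
    fix n x assume n: "n < E" and x: "x \<in> {0..len n}"
    show "(D f n has_real_derivative sign (vtx (2*n)) * (- \<mu> * f n x)) (at x within {0..len n})"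
      by (rule real_derivative_transform[OF x _ DERIV_cmult[OF G(2)[OF f n x]]]) (simp add: D_def n)
    have "sign (vtx (2*n)) * (- \<mu> * G f n x) = - \<mu> * D f n x"
      using n x by (simp add: D_def)
    then show "((\<lambda>x. sign (vtx (2*n)) * (- \<mu> * f n x)) has_real_derivative - \<mu> * D f n x) (at x within {0..len n})"
      using DERIV_cmult[OF DERIV_cmult[OF G(1)[OF f n x]]] by metis
  next
    show "vertex_cond (dual_cond vc) E len vtx (D f) (\<lambda>n x. sign (vtx (2*n)) * (- \<mu> * f n x))"
      using vertex_cond_dual[OF G(3)[OF f], of \<mu>]
      by (subst vertex_cond_cong[where f' = "\<lambda>n x. sign (vtx (2*n)) * G f n x" and
            g' = "\<lambda>n x. sign (vtx (2*n)) * (- \<mu> * f n x)"]) (auto simp: D_def)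
  qed (auto simp: D_def)
  moreover have "\<forall>f\<in>S. c f = 0" if c: "\<And>n x. (\<Sum>f\<in>S. c f * D f n x) = 0" for c
  proof -
    have "(\<Sum>f\<in>S. c f * f n x) = 0" for n x
    proof (cases "n < E \<and> x \<in> {0..len n}")
      case True
      then have n: "n < E" and x: "x \<in> {0..len n}" by auto
      have zero: "(\<Sum>f\<in>S. c f * G f n y) = 0" if "y \<in> {0..len n}" for y
      proof -
        have "sign (vtx (2*n)) * (\<Sum>f\<in>S. c f * G f n y) = (\<Sum>f\<in>S. c f * D f n y)"
          unfolding sum_distrib_left using n that by (intro sum.cong) (auto simp: D_def)
        then show ?thesis
          using c sign_nz by simp
      qed
      \<comment> \<open>The same combination is differentiated twice over: term by term, and as a
        function vanishing on the edge.\<close>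
      have "((\<lambda>y. \<Sum>f\<in>S. c f * G f n y) has_real_derivative (\<Sum>f\<in>S. c f * (- \<mu> * f n x)))
          (at x within {0..len n})"
        by (intro DERIV_sum DERIV_cmult G(2) n x)
      moreover have "((\<lambda>y. \<Sum>f\<in>S. c f * G f n y) has_real_derivative 0) (at x within {0..len n})"
        by (rule real_derivative_transform[OF x _ DERIV_const[of 0]]) (simp add: zero)
      ultimately have "(\<Sum>f\<in>S. c f * (- \<mu> * f n x)) = 0"
        using real_derivative_unique_on_interval x pos n by blast
      also have "(\<Sum>f\<in>S. c f * (- \<mu> * f n x)) = - \<mu> * (\<Sum>f\<in>S. c f * f n x)"
        unfolding sum_distrib_left by (intro sum.cong) auto
      finally show ?thesis
        using \<open>\<mu> \<noteq> 0\<close> by simp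
    next
      case False
      then have "c f * f n x = 0" if "f \<in> S" for f
        using S(2) that by (auto simp: is_eigfun_def subset_iff)
      then show ?thesis
        using sum.neutral[of S "\<lambda>f. c f * f n x"] by blast
    qed
    then show ?thesis
      using S(3) by (auto simp: lin_indep_funs_def)
  qed
  ultimately show ?thesis
    using lin_indep_funs_image[OF S(1), of D] S(1) that[of "D ` S"] by (auto simp: card_image)
qed

text \<open>The sets of cardinalities under \<open>Sup\<close> are equal, as duality maps each into
  the other; no bound on them is required.\<close>

lemma eig_mult_dual:
  assumes "\<mu> \<noteq> 0"
  shows "eig_mult AntiStandard E len vtx \<mu> = eig_mult Standard E len vtx \<mu>"
proof -
  have "{card S |S. finite S \<and> S \<subseteq> {f. is_eigfun vc E len vtx \<mu> f} \<and> lin_indep_funs S} \<subseteq>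
      {card S |S. finite S \<and> S \<subseteq> {f. is_eigfun (dual_cond vc) E len vtx \<mu> f} \<and> lin_indep_funs S}" for vc
  proof
    fix m assume "m \<in> {card S |S. finite S \<and> S \<subseteq> {f. is_eigfun vc E len vtx \<mu> f} \<and> lin_indep_funs S}"
    then obtain S where "m = card S" and S: "finite S" "S \<subseteq> {f. is_eigfun vc E len vtx \<mu> f}" "lin_indep_funs S"
      by blast
    moreover obtain S' where "finite S'" "S' \<subseteq> {f. is_eigfun (dual_cond vc) E len vtx \<mu> f}"
      "lin_indep_funs S'" "card S' = card S"
      by (rule dual_eigfuns[OF S \<open>\<mu> \<noteq> 0\<close>])
    ultimately show "m \<in> {card S |S. finite S \<and> S \<subseteq> {f. is_eigfun (dual_cond vc) E len vtx \<mu> f} \<and> lin_indep_funs S}"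
      by (intro CollectI exI[of _ S']) simp
  qed
  from this[of Standard] this[of AntiStandard] show ?thesis
    unfolding eig_mult_def dual_cond.simps by (metis (no_types, lifting) subset_antisym)
qed

section \<open>Multiplicities of negative numbers and of 0\<close>

lemma eig_mult_neg:
  assumes "\<mu> < 0"
  shows "eig_mult vc E len vtx \<mu> = 0"
proof (rule eig_mult_trivial)
  fix f n x assume f: "is_eigfun vc E len vtx \<mu> f"
  show "f n x = 0"
  proof (cases "n < E \<and> x \<in> {0..len n}")
    case True
    with f assms show ?thesis
      using nonpos_eigfun(2)[OF pos, of \<mu> f _ vc vtx n x] by (auto simp: is_eigfun_def)
  qed (use f in \<open>auto simp: is_eigfun_def\<close>)
qed

text \<open>By \<open>nonpos_eigfun\<close> with \<open>\<mu> = 0\<close> the derivative vanishes on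
  every edge, so only the edge constants remain to satisfy the vertex conditions.\<close>

lemma zero_eigfun_iff:
  "is_eigfun vc E len vtx 0 f \<longleftrightarrow>
    (\<exists>a. f = edgewise_const E len a \<and> vertex_cond vc E len vtx (\<lambda>n x. a n) (\<lambda>n x. 0))"
proof
  assume f: "is_eigfun vc E len vtx 0 f"
  then obtain g where deriv: "\<forall>n<E. \<forall>x\<in>{0..len n}.
        (f n has_real_derivative g n x) (at x within {0..len n}) \<and>
        (g n has_real_derivative (- 0 * f n x)) (at x within {0..len n})"
    and vc: "vertex_cond vc E len vtx f g"
    unfolding is_eigfun_def by blast
  have g0: "g n x = 0" if "n < E" "x \<in> {0..len n}" for n x
    by (rule nonpos_eigfun(1)[OF pos _ deriv vc that]) simp
  have const: "f n x = f n 0" if "n < E" "x \<in> {0..len n}" for n x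
  proof -
    have "\<exists>c. \<forall>y\<in>{0..len n}. f n y = c"
      by (rule has_field_derivative_zero_constant) (use deriv g0 that(1) in auto)
    moreover have "0 \<in> {0..len n}"
      using that by simp
    ultimately show ?thesis
      using that(2) by metis
  qed
  have "f = edgewise_const E len (\<lambda>n. f n 0)"
  proof (intro ext)
    fix n x
    show "f n x = edgewise_const E len (\<lambda>n. f n 0) n x"
      using f const[of n x] unfolding edgewise_const_def is_eigfun_def by (meson not_le)
  qed
  moreover have "vertex_cond vc E len vtx f g \<longleftrightarrow> vertex_cond vc E len vtx (\<lambda>n x. f n 0) (\<lambda>n x. 0)"
    by (rule vertex_cond_cong; (rule const g0; assumption))
  ultimately show "\<exists>a. f = edgewise_const E len a \<and> vertex_cond vc E len vtx (\<lambda>n x. a n) (\<lambda>n x. 0)"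
    using vc by (intro exI[of _ "\<lambda>n. f n 0"]) blast
next
  assume "\<exists>a. f = edgewise_const E len a \<and> vertex_cond vc E len vtx (\<lambda>n x. a n) (\<lambda>n x. 0)"
  then obtain a where f: "f = edgewise_const E len a"
    and vc: "vertex_cond vc E len vtx (\<lambda>n x. a n) (\<lambda>n x. 0)"
    by blast
  show "is_eigfun vc E len vtx 0 f"
    unfolding is_eigfun_def
  proof (intro conjI exI[of _ "\<lambda>n x. 0"] allI impI ballI)
    fix n x assume n: "n < E" and x: "x \<in> {0..len n}"
    show "(f n has_real_derivative 0) (at x within {0..len n})"
      by (rule real_derivative_transform[OF x _ DERIV_const[of "a n"]])
        (simp add: f edgewise_const_def n)
  next
    show "vertex_cond vc E len vtx f (\<lambda>n x. 0)"
      using vc by (subst vertex_cond_cong[where f' = "\<lambda>n x. a n" and g' = "\<lambda>n x. 0"])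
        (auto simp: f edgewise_const_def)
  qed (auto simp: f edgewise_const_def)
qed

definition source :: "nat \<Rightarrow> nat" where
  "source n = (if P (vtx (2*n)) then vtx (2*n) else vtx (2*n+1))"

definition target :: "nat \<Rightarrow> nat" where
  "target n = (if P (vtx (2*n)) then vtx (2*n+1) else vtx (2*n))"

lemma edge_vertices: "n < E \<Longrightarrow> vtx (2*n) \<in> vertices E vtx \<and> vtx (2*n+1) \<in> vertices E vtx"
  by (auto simp: vertices_def endpoints_def)

text \<open>A vertex in the class \<open>P\<close> is only ever a source and a vertex outside it
  only a target, so the unsigned sum is the divergence up to the sign of the class.\<close>

lemma sum_edgewise_const_eq_divergence:
  "(\<Sum>j\<in>endpoints_at E vtx v. fval len (\<lambda>n x. a n) j) = sign v * divergence E source target a v"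
proof -
  have "(\<Sum>j\<in>endpoints_at E vtx v. fval len (\<lambda>n x. a n) j) =
      (\<Sum>j\<in>endpoints E. if vtx j = v then fval len (\<lambda>n x. a n) j else 0)"
    unfolding endpoints_at_def by (rule sum.inter_filter) (simp add: endpoints_def)
  also have "\<dots> = sign v * divergence E source target a v"
    unfolding sum_endpoints fval_double divergence_def sum_distrib_left
  proof (rule sum.cong)
    fix n assume "n \<in> {..<E}"
    then have "P (vtx (2 * n)) \<noteq> P (vtx (2 * n + 1))"
      using bip by simp
    then show "(if vtx (2 * n) = v then a n else 0) + (if vtx (2 * n + 1) = v then a n else 0) =
        sign v * (a n * (of_bool (source n = v) - of_bool (target n = v)))"
      unfolding sign_def source_def target_def by (cases "P (vtx (2 * n))") (simp_all, auto)
  qed simp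
  finally show ?thesis .
qed

lemma zero_anti_iff:
  "is_eigfun AntiStandard E len vtx 0 f \<longleftrightarrow>
    (\<exists>a. f = edgewise_const E len a \<and> (\<forall>v. divergence E source target a v = 0))"
proof -
  \<comment> \<open>Labels that are not vertices meet no edge, which allows the quantifier over all
    \<open>v\<close>.\<close>
  have out: "divergence E source target a v = 0" if "v \<notin> vertices E vtx" for a v
    unfolding divergence_def using that edge_vertices
    by (intro sum.neutral) (auto simp: source_def target_def)
  have "vertex_cond AntiStandard E len vtx (\<lambda>n x. a n) (\<lambda>n x. 0) \<longleftrightarrow>
      (\<forall>v. divergence E source target a v = 0)" for a
    using out[of _ a] sign_nz
    by (auto simp: vertex_cond_def sum_edgewise_const_eq_divergence dval_def)
  then show ?thesis
    by (simp add: zero_eigfun_iff)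
qed

lemma zero_standard_iff:
  "is_eigfun Standard E len vtx 0 f \<longleftrightarrow> (\<exists>c. f = edgewise_const E len (\<lambda>n. c))"
proof
  assume "is_eigfun Standard E len vtx 0 f"
  then obtain a where f: "f = edgewise_const E len a"
    and vc: "vertex_cond Standard E len vtx (\<lambda>n x. a n) (\<lambda>n x. 0)"
    using zero_eigfun_iff by blast
  have eq: "a (i div 2) = a (j div 2)" if "i \<in> endpoints E" "j \<in> endpoints E" "vtx i = vtx j" for i j
  proof -
    have "vtx j \<in> vertices E vtx" "i \<in> endpoints_at E vtx (vtx j)" "j \<in> endpoints_at E vtx (vtx j)"
      using that by (auto simp: vertices_def endpoints_at_def)
    then have "fval len (\<lambda>n x. a n) i = fval len (\<lambda>n x. a n) j"
      using vc unfolding vertex_cond_def vertex_conditions.case by blast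
    then show ?thesis
      by (simp add: fval_def)
  qed
  \<comment> \<open>The vertices at which the value is \<open>a 0\<close>. Continuity, in the form
    \<open>eq\<close>, makes membership independent of the chosen endpoint; an edge leaving
    \<open>W\<close> would carry two different constants.\<close>
  define W where "W = vtx ` {j \<in> endpoints E. a (j div 2) = a 0}"
  have mem_W: "vtx j \<in> W \<longleftrightarrow> a (j div 2) = a 0" if "j \<in> endpoints E" for j
  proof
    assume "vtx j \<in> W"
    then obtain i where "i \<in> endpoints E" "a (i div 2) = a 0" "vtx i = vtx j"
      unfolding W_def by force
    then show "a (j div 2) = a 0"
      using eq that by metis
  qed (use that in \<open>simp add: W_def\<close>)
  have "a n = a 0" if n: "n < E" for n
  proof (rule ccontr)
    assume an: "a n \<noteq> a 0"
    have ends: "2 * m \<in> endpoints E" "2 * m + 1 \<in> endpoints E" if "m < E" for m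
      using that by (auto simp: endpoints_def)
    have "W \<subseteq> vertices E vtx"
      by (auto simp: W_def vertices_def)
    moreover have "vtx 0 \<in> W"
      using mem_W[of 0] n by (simp add: endpoints_def)
    moreover have "W \<noteq> vertices E vtx"
      using mem_W[OF ends(1)[OF n]] an edge_vertices[OF n] by auto
    ultimately obtain m where "m < E" "(vtx (2*m) \<in> W) \<noteq> (vtx (2*m+1) \<in> W)"
      using ex_crossing_edge by blast
    then show False
      using mem_W ends by simp
  qed
  then show "\<exists>c. f = edgewise_const E len (\<lambda>n. c)"
    unfolding f by (intro exI[of _ "a 0"] ext) (metis edgewise_const_def)
next
  assume "\<exists>c. f = edgewise_const E len (\<lambda>n. c)"
  moreover have "vertex_cond Standard E len vtx (\<lambda>n x. c) (\<lambda>n x. 0)" for c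
    by (simp add: vertex_cond_def fval_def dval_def cong: if_cong)
  ultimately show "is_eigfun Standard E len vtx 0 f"
    unfolding zero_eigfun_iff by blast
qed

text \<open>The constant 1 is a basis; it is nonzero because there is an edge.\<close>

lemma eig_mult_standard_zero:
  assumes "0 < E"
  shows "eig_mult Standard E len vtx 0 = 1"
proof -
  have "eig_mult Standard E len vtx 0 = card {()}"
  proof (rule eig_mult_eq_card[where h = "\<lambda>_. edgewise_const E len (\<lambda>n. 1)"])
    fix c :: "unit \<Rightarrow> real"
    assume "\<And>n x. (\<Sum>b\<in>{()}. c b * edgewise_const E len (\<lambda>n. 1) n x) = 0"
    from this[of 0 0] show "\<forall>b\<in>{()}. c b = 0"
      using assms pos by (simp add: edgewise_const_def less_imp_le)
  next
    fix f assume "is_eigfun Standard E len vtx 0 f"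
    then obtain c where "f = edgewise_const E len (\<lambda>n. c)"
      using zero_standard_iff by blast
    then show "\<exists>c. \<forall>n x. f n x = (\<Sum>b\<in>{()}. c b * edgewise_const E len (\<lambda>n. 1) n x)"
      by (intro exI[of _ "\<lambda>_. c"]) (simp add: edgewise_const_def)
  qed (auto simp: zero_standard_iff)
  then show ?thesis
    by simp
qed

text \<open>The fundamental cycles, read as edgewise constant functions, form a basis. Their number
  gives \<open>card F + card ?V = E + 1\<close>, so the natural subtraction in \<open>betti\<close>
  does not truncate.\<close>

lemma eig_mult_anti_zero:
  assumes "0 < E"
  shows "eig_mult AntiStandard E len vtx 0 = betti E vtx"
proof -
  let ?V = "vertices E vtx"
  have V: "finite ?V" "vtx 0 \<in> ?V"
    using assms by (simp_all add: vertices_def endpoints_def)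
  have ends: "source n \<in> ?V \<and> target n \<in> ?V" if "n < E" for n
    using edge_vertices[OF that] by (simp add: source_def target_def)
  have cut: "\<exists>n<E. (source n \<in> W) \<noteq> (target n \<in> W)"
    if "W \<subseteq> ?V" "vtx 0 \<in> W" "W \<noteq> ?V" for W
    using ex_crossing_edge[OF that] by (auto simp: source_def target_def)
  obtain F c where F: "F \<subseteq> {..<E}" "card F + card ?V = E + 1"
    and c_flow: "\<forall>e\<in>F. \<forall>v. divergence E source target (c e) v = 0"
    and c_delta: "\<forall>e\<in>F. \<forall>m\<in>F. c e m = of_bool (e = m)"
    and c_span: "\<forall>a. (\<forall>v. divergence E source target a v = 0) \<longrightarrow> (\<forall>n<E. a n = (\<Sum>e\<in>F. a e * c e n))"
    by (rule cycle_basis[OF V ends cut])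
  have finF: "finite F"
    using F(1) finite_subset by blast
  have "eig_mult AntiStandard E len vtx 0 = card F"
  proof (rule eig_mult_eq_card[where h = "\<lambda>e. edgewise_const E len (c e)"])
    show "is_eigfun AntiStandard E len vtx 0 (edgewise_const E len (c e))" if "e \<in> F" for e
      using zero_anti_iff c_flow that by blast
  next
    fix y :: "nat \<Rightarrow> real"
    assume y: "\<And>n x. (\<Sum>e\<in>F. y e * edgewise_const E len (c e) n x) = 0"
    show "\<forall>m\<in>F. y m = 0"
    proof
      fix m assume m: "m \<in> F"
      \<comment> \<open>Evaluation at the left end of edge \<open>m\<close> isolates the coefficient
        \<open>y m\<close>.\<close>
      have "(\<Sum>e\<in>F. y e * edgewise_const E len (c e) m 0) = (\<Sum>e\<in>F. if e = m then y e else 0)"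
        using m F(1) pos c_delta by (intro sum.cong) (auto simp: edgewise_const_def less_imp_le)
      then show "y m = 0"
        using y m finF by simp
    qed
  next
    fix f assume "is_eigfun AntiStandard E len vtx 0 f"
    then obtain a where f: "f = edgewise_const E len a" and a: "\<forall>v. divergence E source target a v = 0"
      using zero_anti_iff by blast
    have "f n x = (\<Sum>e\<in>F. a e * edgewise_const E len (c e) n x)" for n x
      using c_span[rule_format, OF a[rule_format], of n]
      by (cases "n < E \<and> x \<in> {0..len n}") (auto simp: f edgewise_const_def)
    then show "\<exists>y. \<forall>n x. f n x = (\<Sum>e\<in>F. y e * edgewise_const E len (c e) n x)"
      by blast
  qed (rule finF)
  then show ?thesis
    using F(2) by (simp add: betti_def)
qed

section \<open>Comparison of the counting functions and of the eigenvalues\<close>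

text \<open>For \<open>0 \<le> lam\<close> and finite \<open>Q\<close> the counts are
  \<open>betti E vtx\<close> and 1 plus a common sum over \<open>Q\<close>. In all other cases both
  counts are 0, and both inequalities fail since \<open>k\<close> is positive.\<close>

lemma eig_count_compare:
  assumes "1 \<le> k"
  shows "k + betti E vtx \<le> eig_count AntiStandard E len vtx lam \<longleftrightarrow>
    k + 1 \<le> eig_count Standard E len vtx lam"
proof (cases "0 < E \<and> 0 \<le> lam")
  case True
  then have E: "0 < E" and lam: "0 \<le> lam" by auto
  define Q where "Q = {\<mu>. 0 < \<mu> \<and> \<mu> \<le> lam \<and> 0 < eig_mult Standard E len vtx \<mu>}"
  have Q: "{\<mu>. 0 < \<mu> \<and> \<mu> \<le> lam \<and> 0 < eig_mult AntiStandard E len vtx \<mu>} = Q"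
    using eig_mult_dual by (auto simp: Q_def)
  have "(\<Sum>\<mu>\<in>Q. eig_mult AntiStandard E len vtx \<mu>) = (\<Sum>\<mu>\<in>Q. eig_mult Standard E len vtx \<mu>)"
    using eig_mult_dual by (intro sum.cong) (auto simp: Q_def)
  then show ?thesis
    using eig_count_eq[OF eig_mult_neg lam, of AntiStandard] eig_count_eq[OF eig_mult_neg lam, of Standard]
      eig_mult_standard_zero[OF E] eig_mult_anti_zero[OF E] assms
    unfolding Q Q_def[symmetric] by (simp split: if_splits)
next
  case False
  have "eig_mult vc E len vtx \<mu> = 0" if "\<mu> \<le> lam" for vc \<mu>
  proof (cases "E = 0")
    case True
    then show ?thesis
      by (intro eig_mult_trivial) (auto simp: is_eigfun_def)
  next
    assume "E \<noteq> 0"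
    with False that show ?thesis
      by (intro eig_mult_neg) simp
  qed
  then have "eig_count vc E len vtx lam = 0" for vc
    by (simp add: eig_count_def)
  then show ?thesis
    using assms by simp
qed

end

theorem mainTheorem3:
  fixes E :: nat and len :: "nat \<Rightarrow> real" and vtx :: "nat \<Rightarrow> nat" and k :: nat
  assumes "\<forall>n<E. 0 < len n"
    and "connected_graph E vtx"
    and "bipartite_graph E vtx"
    and "1 \<le> k"
  shows "eigenvalue AntiStandard E len vtx (k + betti E vtx)
         = eigenvalue Standard E len vtx (k + 1)"
proof -
  obtain P where "bipartite_metric_graph E len vtx P"
    using assms by (auto simp: bipartite_graph_def bipartite_metric_graph_def)
  then interpret bipartite_metric_graph E len vtx P .
  \<comment> \<open>The two sets under \<open>Inf\<close> are the same, so their infima agree even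
    if the sets were empty.\<close>
  show ?thesis
    unfolding eigenvalue_def eig_count_compare[OF \<open>1 \<le> k\<close>] ..
qed

end
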